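(* Let $\mathcal S=(G=(V,E),q,b,A)$ be a spin system which exhibits strong spatial mixing with rate $f$, and fix $\ell\in\mathbb N$. Suppose that for all $v\in V$, all finite $\Lambda\subset V$ with $v\notin\Lambda$, and all $\sigma\in\Omega_\Lambda$ with $\mu_\Lambda(\sigma)>0$, the algorithm $\textsc{ssms}(\mathcal S,(\Lambda,\sigma),v,\ell)$ terminates with probability 1. Then for all such $v,\Lambda,\sigma$ and all $i\in[q]$, the probability that $\textsc{ssms}(\mathcal S,(\Lambda,\sigma),v,\ell)$ assigns spin $i$ to $v$ equals $\mu_v^\sigma(i)$.
   Context: A spin system $\mathcal S=(G,q,b,A)$: $G=(V,E)$ countable locally finite, $q$ spins, field $b:[q]\to\mathbb R$, symmetric $A:[q]\times[q]\to\mathbb R$; $\Omega_W=[q]^W$. A Gibbs measure $\mu$ is a probability measure on $[q]^V$ whose conditional distribution on any finite $W$ given the spins on its outer boundary is proportional to $\prod_{w\in W}b(\sigma_w)\prod A(\sigma_x,\sigma_y)$ over edges meeting $W$. $\mu_W$ is the marginal on $W$; feasible means positive marginal probability; $\mu_W^{\tau}$ is the conditional marginal on $W$ given the partial configuration $\tau$; $\mu_v=\mu_{\{v\}}$; $\oplus$ is concatenation. $S_\ell(v)=\{w:d_G(v,w)=\ell\}$. Strong spatial mixing with rate $f:\mathbb N\to\mathbb R^+$: for all $W\subset V$ with $V\setminus W$ finite, all $v\in V\setminus W$ and all feasible $\tau^1\ne\tau^2\in\Omega_W$, $d_{\mathrm{TV}}(\mu_v^{\tau^1},\mu_v^{\tau^2})\le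 f(\ell)$ where $\ell=\min\{d_G(v,w):\tau^1_w\ne\tau^2_w\}$; this implies a unique Gibbs measure $\mu$. Algorithm $\textsc{ssms}(\mathcal S,(\Lambda,\sigma),v,\ell)$, for $\sigma\in\Omega_\Lambda$, $v\notin\Lambda$: let $S=S_\ell(v)$; set $p_v^i=\min_{\tau\in\Omega_{S\setminus\Lambda}}\mu_v^{\sigma\oplus\tau}(i)$ for $i\in[q]$, $I_i=[\sum_{j<i}p_v^j,\sum_{j\le i}p_v^j)$, $p_v^0=1-\sum_i p_v^i$, $I_0=[1-p_v^0,1]$. Draw $y\sim U[0,1]$. If $y\in I_i$, $i\in[q]$, return $(\Lambda,\sigma)\oplus(v,i)$. Otherwise order $S\setminus\Lambda=\{w_1,\dots,w_m\}$, set $(\Lambda',\sigma')=(\Lambda,\sigma)$ and for $j=1,\dots,m$ replace $(\Lambda',\sigma')$ by $\textsc{ssms}(\mathcal S,(\Lambda',\sigma'),w_j,\ell)$; let $\rho_v^i=\mu_v^{\sigma'}(i)-p_v^i$, $J_i=[\sum_jp_v^j+\sum_{k<i}\rho_v^k,\sum_jp_v^j+\sum_{k\le i}\rho_v^k)$, and return $(\Lambda,\sigma)\oplus(v,i)$ for the $i$ with $y\in J_i$ (spins assigned during recursive calls are discarded). *)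

theory Defs
  imports "HOL-Probability.Probability" "HOL-Library.Extended_Nat"
begin

section \<open>Spin systems and Gibbs measures\<close>

record 'v spin_system =
  verts :: "'v set"
  edges :: "'v set set"
  nspins :: nat
  field :: "nat \<Rightarrow> real"
  interaction :: "nat \<Rightarrow> nat \<Rightarrow> real"

definition is_spin_system :: "'v spin_system \<Rightarrow> bool" where
  "is_spin_system S \<longleftrightarrow>
     countable (verts S) \<and>
     (\<forall>e\<in>edges S. e \<subseteq> verts S \<and> card e = 2) \<and>
     (\<forall>v\<in>verts S. finite {e \<in> edges S. v \<in> e}) \<and>
     (\<forall>i\<in>{1..nspins S}. \<forall>j\<in>{1..nspins S}. interaction S i j = interaction S j i)"

definition adj_rel :: "'v spin_system \<Rightarrow> ('v \<times> 'v) set" where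
  "adj_rel S = {(x, y). {x, y} \<in> edges S}"

text \<open>Graph distance; it is \<open>\<infinity>\<close> between different components.\<close>

definition gdist :: "'v spin_system \<Rightarrow> 'v \<Rightarrow> 'v \<Rightarrow> enat" where
  "gdist S v w = Inf {enat n | n. (v, w) \<in> adj_rel S ^^ n}"

definition gsphere :: "'v spin_system \<Rightarrow> nat \<Rightarrow> 'v \<Rightarrow> 'v set" where
  "gsphere S l v = {w \<in> verts S. gdist S v w = enat l}"

definition outer_boundary :: "'v spin_system \<Rightarrow> 'v set \<Rightarrow> 'v set" where
  "outer_boundary S W = {u \<in> verts S - W. \<exists>w\<in>W. {u, w} \<in> edges S}"

text \<open>A pair of a region \<open>W\<close> and a spin assignment on \<open>W\<close> is encoded as a partial map with
  domain \<open>W\<close>, so that concatenation of partial configurations is \<open>++\<close>.\<close>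

definition configs :: "'v spin_system \<Rightarrow> 'v set \<Rightarrow> ('v \<rightharpoonup> nat) set" where
  "configs S W = {\<sigma>. dom \<sigma> = W \<and> ran \<sigma> \<subseteq> {1..nspins S}}"

text \<open>The description below does not depend on the choice of \<open>x\<close> and \<open>y\<close> because the
  interaction is symmetric.\<close>

definition edge_factor :: "'v spin_system \<Rightarrow> ('v \<rightharpoonup> nat) \<Rightarrow> 'v set \<Rightarrow> real" where
  "edge_factor S \<sigma> e =
     (THE a. \<exists>x y. e = {x, y} \<and> a = interaction S (the (\<sigma> x)) (the (\<sigma> y)))"

definition weight :: "'v spin_system \<Rightarrow> 'v set \<Rightarrow> ('v \<rightharpoonup> nat) \<Rightarrow> real" where
  "weight S W \<sigma> =
     (\<Prod>w\<in>W. field S (the (\<sigma> w))) * (\<Prod>e | e \<in> edges S \<and> e \<inter> W \<noteq> {}. edge_factor S \<sigma> e)"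

text \<open>The distribution on a finite region \<open>W\<close> proportional to the weight, with boundary
  condition \<open>\<tau>\<close> defined at least on the outer boundary of \<open>W\<close>.\<close>

definition gibbs_kernel :: "'v spin_system \<Rightarrow> 'v set \<Rightarrow> ('v \<rightharpoonup> nat) \<Rightarrow> ('v \<rightharpoonup> nat) \<Rightarrow> real" where
  "gibbs_kernel S W \<tau> \<omega> =
     weight S W (\<tau> ++ \<omega>) / (\<Sum>\<omega>'\<in>configs S W. weight S W (\<tau> ++ \<omega>'))"

definition agrees :: "('v \<Rightarrow> nat) \<Rightarrow> ('v \<rightharpoonup> nat) \<Rightarrow> bool" where
  "agrees \<eta> \<sigma> \<longleftrightarrow> (\<forall>x\<in>dom \<sigma>. \<sigma> x = Some (\<eta> x))"

text \<open>The marginal probability of \<open>\<sigma>\<close> on the region \<open>dom \<sigma>\<close>.\<close>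

definition marg_prob :: "('v \<Rightarrow> nat) measure \<Rightarrow> ('v \<rightharpoonup> nat) \<Rightarrow> real" where
  "marg_prob \<mu> \<sigma> = \<P>(\<eta> in \<mu>. agrees \<eta> \<sigma>)"

text \<open>The conditional probability of spin \<open>i\<close> at \<open>v\<close> given the partial configuration \<open>\<sigma>\<close>,
  for \<open>\<sigma>\<close> of positive marginal probability.\<close>

definition cond_marg :: "('v \<Rightarrow> nat) measure \<Rightarrow> ('v \<rightharpoonup> nat) \<Rightarrow> 'v \<Rightarrow> nat \<Rightarrow> real" where
  "cond_marg \<mu> \<sigma> v i = \<P>(\<eta> in \<mu>. \<eta> v = i \<bar> agrees \<eta> \<sigma>)"

text \<open>If the normalising sum of \<open>gibbs_kernel\<close> vanishes, then the kernel is identically \<open>0\<close>,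
  whereas the conditional probabilities sum to \<open>1\<close>. Hence the equation below forces this sum to
  be nonzero for every boundary condition of positive probability.\<close>

definition gibbs_measure :: "'v spin_system \<Rightarrow> ('v \<Rightarrow> nat) measure \<Rightarrow> bool" where
  "gibbs_measure S \<mu> \<longleftrightarrow>
     prob_space \<mu> \<and>
     sets \<mu> = sets (\<Pi>\<^sub>M v\<in>verts S. count_space {1..nspins S}) \<and>
     (\<forall>W \<tau> \<omega>. finite W \<and> W \<subseteq> verts S \<and> \<tau> \<in> configs S (outer_boundary S W) \<and>
        0 < marg_prob \<mu> \<tau> \<and> \<omega> \<in> configs S W \<longrightarrow>
        \<P>(\<eta> in \<mu>. agrees \<eta> \<omega> \<bar> agrees \<eta> \<tau>) = gibbs_kernel S W \<tau> \<omega>)"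


section \<open>Strong spatial mixing\<close>

text \<open>Strong spatial mixing concerns configurations on cofinite regions \<open>W\<close>. If \<open>W\<close> is infinite,
  a single configuration typically has probability \<open>0\<close>, so feasibility asks for positive
  marginal probability of every finite restriction. For finite \<open>dom \<tau>\<close> this is the same as
  positive marginal probability of \<open>\<tau>\<close>. The measure is quantified because strong spatial
  mixing is a property of the spin system, prior to uniqueness of the Gibbs measure.\<close>

definition feasible :: "'v spin_system \<Rightarrow> ('v \<rightharpoonup> nat) \<Rightarrow> bool" where
  "feasible S \<tau> \<longleftrightarrow>
     (\<exists>\<mu>. gibbs_measure S \<mu> \<and> (\<forall>D. finite D \<and> D \<subseteq> dom \<tau> \<longrightarrow> 0 < marg_prob \<mu> (\<tau> |` D)))"

text \<open>The conditional marginal at \<open>v\<close> given \<open>\<tau>\<close> on a cofinite region. The complement of the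
  region is finite, so the law there is the one prescribed for every Gibbs measure.\<close>

definition cofinite_cond_marg :: "'v spin_system \<Rightarrow> ('v \<rightharpoonup> nat) \<Rightarrow> 'v \<Rightarrow> nat \<Rightarrow> real" where
  "cofinite_cond_marg S \<tau> v i =
     (\<Sum>\<omega> | \<omega> \<in> configs S (verts S - dom \<tau>) \<and> \<omega> v = Some i.
        gibbs_kernel S (verts S - dom \<tau>) \<tau> \<omega>)"

definition tv_dist :: "'v spin_system \<Rightarrow> (nat \<Rightarrow> real) \<Rightarrow> (nat \<Rightarrow> real) \<Rightarrow> real" where
  "tv_dist S p r = (\<Sum>i\<in>{1..nspins S}. \<bar>p i - r i\<bar>) / 2"

text \<open>The infimum below is the least distance from \<open>v\<close> to a disagreement; it equals \<open>\<infinity>\<close>,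
  where \<open>f\<close> has no value, iff no disagreement lies in the component of \<open>v\<close>.\<close>

definition strong_spatial_mixing :: "'v spin_system \<Rightarrow> (nat \<Rightarrow> real) \<Rightarrow> bool" where
  "strong_spatial_mixing S f \<longleftrightarrow>
     (\<forall>n. 0 \<le> f n) \<and>
     (\<forall>W v \<tau>1 \<tau>2 l. W \<subseteq> verts S \<and> finite (verts S - W) \<and> v \<in> verts S - W \<and>
        \<tau>1 \<in> configs S W \<and> \<tau>2 \<in> configs S W \<and> feasible S \<tau>1 \<and> feasible S \<tau>2 \<and> \<tau>1 \<noteq> \<tau>2 \<and>
        (INF w\<in>{w \<in> W. \<tau>1 w \<noteq> \<tau>2 w}. gdist S v w) = enat l \<longrightarrow>
        tv_dist S (cofinite_cond_marg S \<tau>1 v) (cofinite_cond_marg S \<tau>2 v) \<le> f l)"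


section \<open>The sampling algorithm\<close>

text \<open>The minimum ranges over the \<open>\<tau>\<close> for which the conditional marginal is defined.\<close>

definition p_low :: "'v spin_system \<Rightarrow> ('v \<Rightarrow> nat) measure \<Rightarrow> nat \<Rightarrow> ('v \<rightharpoonup> nat) \<Rightarrow> 'v \<Rightarrow> nat \<Rightarrow> real" where
  "p_low S \<mu> l \<sigma> v i =
     Min {cond_marg \<mu> (\<sigma> ++ \<tau>) v i | \<tau>.
            \<tau> \<in> configs S (gsphere S l v - dom \<sigma>) \<and> 0 < marg_prob \<mu> (\<sigma> ++ \<tau>)}"

definition p_zero :: "'v spin_system \<Rightarrow> ('v \<Rightarrow> nat) measure \<Rightarrow> nat \<Rightarrow> ('v \<rightharpoonup> nat) \<Rightarrow> 'v \<Rightarrow> real" where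
  "p_zero S \<mu> l \<sigma> v = 1 - (\<Sum>i\<in>{1..nspins S}. p_low S \<mu> l \<sigma> v i)"

definition I_int :: "'v spin_system \<Rightarrow> ('v \<Rightarrow> nat) measure \<Rightarrow> nat \<Rightarrow> ('v \<rightharpoonup> nat) \<Rightarrow> 'v \<Rightarrow> nat \<Rightarrow> real set" where
  "I_int S \<mu> l \<sigma> v i =
     {(\<Sum>j\<in>{1..<i}. p_low S \<mu> l \<sigma> v j) ..< (\<Sum>j\<in>{1..i}. p_low S \<mu> l \<sigma> v j)}"

definition I_zero :: "'v spin_system \<Rightarrow> ('v \<Rightarrow> nat) measure \<Rightarrow> nat \<Rightarrow> ('v \<rightharpoonup> nat) \<Rightarrow> 'v \<Rightarrow> real set" where
  "I_zero S \<mu> l \<sigma> v = {1 - p_zero S \<mu> l \<sigma> v .. 1}"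

text \<open>Here \<open>\<sigma>\<close> is the input configuration and \<open>\<sigma>'\<close> its extension to the sphere.\<close>

definition rho :: "'v spin_system \<Rightarrow> ('v \<Rightarrow> nat) measure \<Rightarrow> nat \<Rightarrow> ('v \<rightharpoonup> nat) \<Rightarrow> ('v \<rightharpoonup> nat) \<Rightarrow> 'v \<Rightarrow> nat \<Rightarrow> real" where
  "rho S \<mu> l \<sigma> \<sigma>' v i = cond_marg \<mu> \<sigma>' v i - p_low S \<mu> l \<sigma> v i"

definition J_int :: "'v spin_system \<Rightarrow> ('v \<Rightarrow> nat) measure \<Rightarrow> nat \<Rightarrow> ('v \<rightharpoonup> nat) \<Rightarrow> ('v \<rightharpoonup> nat) \<Rightarrow> 'v \<Rightarrow> nat \<Rightarrow> real set" where
  "J_int S \<mu> l \<sigma> \<sigma>' v i =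
     {(\<Sum>j\<in>{1..nspins S}. p_low S \<mu> l \<sigma> v j) + (\<Sum>k\<in>{1..<i}. rho S \<mu> l \<sigma> \<sigma>' v k) ..<
      (\<Sum>j\<in>{1..nspins S}. p_low S \<mu> l \<sigma> v j) + (\<Sum>k\<in>{1..i}. rho S \<mu> l \<sigma> \<sigma>' v k)}"

text \<open>An order in which a call with input \<open>\<sigma>\<close> and \<open>v\<close> visits the unassigned sphere vertices.\<close>

definition sphere_ordering :: "'v spin_system \<Rightarrow> nat \<Rightarrow> (('v \<rightharpoonup> nat) \<Rightarrow> 'v \<Rightarrow> 'v list) \<Rightarrow> bool" where
  "sphere_ordering S l enum \<longleftrightarrow>
     (\<forall>\<sigma>. \<forall>v\<in>verts S. distinct (enum \<sigma> v) \<and> set (enum \<sigma> v) = gsphere S l v - dom \<sigma>)"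

text \<open>The randomness is an infinite tape of independent uniform samples. The relation
  \<open>ssms S \<mu> l enum \<sigma> v s \<sigma>' s'\<close> says that the call with input \<open>\<sigma>\<close> and \<open>v\<close>, started on tape \<open>s\<close>,
  halts with output \<open>\<sigma>'\<close> and leaves the tape \<open>s'\<close>; \<open>ssms_loop\<close> is the loop over the sphere.
  Finite derivations are halting executions, so a run diverges on \<open>s\<close> iff no \<open>\<sigma>'\<close> and \<open>s'\<close>
  exist. For \<open>y\<close> in the unit interval, \<open>y \<in> I_zero\<close> holds iff \<open>y\<close> is in no \<open>I_int\<close>. The
  intervals \<open>J_int\<close> tile \<open>I_zero\<close> up to the point \<open>1\<close>, which has probability \<open>0\<close>; with \<open>y = 1\<close>
  no output is produced.\<close>

inductive
  ssms :: "'v spin_system \<Rightarrow> ('v \<Rightarrow> nat) measure \<Rightarrow> nat \<Rightarrow> (('v \<rightharpoonup> nat) \<Rightarrow> 'v \<Rightarrow> 'v list) \<Rightarrow>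
    ('v \<rightharpoonup> nat) \<Rightarrow> 'v \<Rightarrow> real stream \<Rightarrow> ('v \<rightharpoonup> nat) \<Rightarrow> real stream \<Rightarrow> bool" and
  ssms_loop :: "'v spin_system \<Rightarrow> ('v \<Rightarrow> nat) measure \<Rightarrow> nat \<Rightarrow> (('v \<rightharpoonup> nat) \<Rightarrow> 'v \<Rightarrow> 'v list) \<Rightarrow>
    'v list \<Rightarrow> ('v \<rightharpoonup> nat) \<Rightarrow> real stream \<Rightarrow> ('v \<rightharpoonup> nat) \<Rightarrow> real stream \<Rightarrow> bool"
  for S \<mu> l enum where
  direct: "i \<in> {1..nspins S} \<Longrightarrow> y \<in> I_int S \<mu> l \<sigma> v i \<Longrightarrow>
    ssms S \<mu> l enum \<sigma> v (y ## s) (\<sigma>(v \<mapsto> i)) s"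
| recursive: "y \<in> I_zero S \<mu> l \<sigma> v \<Longrightarrow>
    ssms_loop S \<mu> l enum (enum \<sigma> v) \<sigma> s \<sigma>' s' \<Longrightarrow>
    i \<in> {1..nspins S} \<Longrightarrow> y \<in> J_int S \<mu> l \<sigma> \<sigma>' v i \<Longrightarrow>
    ssms S \<mu> l enum \<sigma> v (y ## s) (\<sigma>(v \<mapsto> i)) s'"
| loop_nil: "ssms_loop S \<mu> l enum [] \<sigma> s \<sigma> s"
| loop_cons: "ssms S \<mu> l enum \<sigma> w s \<sigma>' s' \<Longrightarrow> ssms_loop S \<mu> l enum ws \<sigma>' s' \<sigma>'' s'' \<Longrightarrow>
    ssms_loop S \<mu> l enum (w # ws) \<sigma> s \<sigma>'' s''"

definition random_tape :: "real stream measure" where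
  "random_tape = stream_space (uniform_measure lborel {0..1})"

definition termination_prob :: "'v spin_system \<Rightarrow> ('v \<Rightarrow> nat) measure \<Rightarrow> nat \<Rightarrow>
    (('v \<rightharpoonup> nat) \<Rightarrow> 'v \<Rightarrow> 'v list) \<Rightarrow> ('v \<rightharpoonup> nat) \<Rightarrow> 'v \<Rightarrow> real" where
  "termination_prob S \<mu> l enum \<sigma> v =
     \<P>(s in random_tape. \<exists>\<sigma>' s'. ssms S \<mu> l enum \<sigma> v s \<sigma>' s')"

definition assign_prob :: "'v spin_system \<Rightarrow> ('v \<Rightarrow> nat) measure \<Rightarrow> nat \<Rightarrow>
    (('v \<rightharpoonup> nat) \<Rightarrow> 'v \<Rightarrow> 'v list) \<Rightarrow> ('v \<rightharpoonup> nat) \<Rightarrow> 'v \<Rightarrow> nat \<Rightarrow> real" where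
  "assign_prob S \<mu> l enum \<sigma> v i =
     \<P>(s in random_tape. \<exists>\<sigma>' s'. ssms S \<mu> l enum \<sigma> v s \<sigma>' s' \<and> \<sigma>' v = Some i)"

end

theory Submission
  imports Defs
begin

text \<open>By induction on the recursion depth, a call with input \<open>\<sigma>\<close> and \<open>v\<close> assigns spin \<open>i\<close> within depth
  \<open>n\<close> with probability at most \<open>\<mu>\<^sub>v\<^sup>\<sigma>(i)\<close>: the direct case contributes at most \<open>p\<^sub>v\<^sup>i\<close>; in the recursive
  case the loop produces an extension \<open>\<sigma>'\<close> of \<open>\<sigma>\<close> with probability at most \<open>\<mu>(\<sigma>') / \<mu>(\<sigma>)\<close> by the
  chain rule, and then \<open>y\<close> falls into an interval of length \<open>\<mu>\<^sub>v\<^bsup>\<sigma>'\<^esup>(i) - p\<^sub>v\<^sup>i\<close>; these terms sum to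
  \<open>\<mu>\<^sub>v\<^sup>\<sigma>(i) - p\<^sub>v\<^sup>i\<close>. In the limit the output law lies below \<open>\<mu>\<^sub>v\<^sup>\<sigma>\<close>. If the call terminates almost
  surely, then both have total mass \<open>1\<close>, so they coincide. Since upper bounds suffice, a union bound replaces any
  disjointness of the events.\<close>

section \<open>The random tape\<close>

text \<open>A call reads one sample and hands on the rest of the tape, so its events are assembled
  from such product sets.\<close>

definition cyl :: "real set \<Rightarrow> real stream set \<Rightarrow> real stream set" where
  "cyl I B = {s. shd s \<in> I \<and> stl s \<in> B}"

lemma prob_space_unit: "prob_space (uniform_measure lborel {0..1::real})"
  by (rule prob_space_uniform_measure) auto

lemma prob_space_random_tape: "prob_space random_tape"
  unfolding random_tape_def by (rule prob_space.prob_space_stream_space[OF prob_space_unit])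

lemma space_random_tape [simp]: "space random_tape = UNIV"
  unfolding random_tape_def by (simp add: space_stream_space)

lemma cyl_sets [measurable]:
  assumes "I \<in> sets borel" "B \<in> sets random_tape"
  shows "cyl I B \<in> sets random_tape"
proof -
  let ?U = "uniform_measure lborel {0..1::real}"
  have [measurable]: "I \<in> sets ?U" "B \<in> sets (stream_space ?U)"
    using assms by (auto simp: random_tape_def)
  have "{s \<in> space (stream_space ?U). shd s \<in> I \<and> stl s \<in> B} \<in> sets (stream_space ?U)"
    by measurable
  then show ?thesis
    by (simp add: cyl_def random_tape_def space_stream_space)
qed

text \<open>The head of the tape is independent of the tail, and the tail is distributed like the
  whole tape.\<close>

lemma measure_cyl:
  assumes "I \<in> sets borel" "B \<in> sets random_tape"
  shows "measure random_tape (cyl I B) =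
    measure (uniform_measure lborel {0..1}) I * measure random_tape B"
proof -
  let ?U = "uniform_measure lborel {0..1::real}"
  let ?T = "stream_space ?U"
  interpret U: prob_space ?U by (rule prob_space_unit)
  interpret T: prob_space ?T by (rule U.prob_space_stream_space)
  have B: "B \<in> sets ?T" using assms by (simp add: random_tape_def)
  have C: "cyl I B \<in> sets ?T" using cyl_sets[OF assms] by (simp add: random_tape_def)
  have "emeasure ?T (cyl I B) = (\<integral>\<^sup>+y. emeasure ?T {s \<in> space ?T. y ## s \<in> cyl I B} \<partial>?U)"
    by (rule U.emeasure_stream_space[OF C])
  also have "\<dots> = (\<integral>\<^sup>+y. emeasure ?T B * indicator I y \<partial>?U)"
    by (intro nn_integral_cong) (auto simp: cyl_def space_stream_space split: split_indicator)
  also have "\<dots> = emeasure ?U I * emeasure ?T B"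
    using assms by (subst nn_integral_cmult_indicator) (auto simp: mult.commute)
  finally show ?thesis
    by (simp add: measure_def random_tape_def enn2real_mult)
qed

text \<open>The interval may stick out of the unit interval, hence only an upper bound.\<close>

lemma measure_unit_interval_le:
  assumes "a \<le> b"
  shows "measure (uniform_measure lborel {0..1::real}) {a..<b} \<le> b - a"
proof -
  have "emeasure (uniform_measure lborel {0..1::real}) {a..<b} \<le> emeasure lborel {a..<b}"
    by (auto simp: divide_ennreal_def intro!: emeasure_mono)
  then show ?thesis
    using assms by (simp add: measure_def enn2real_leI)
qed

section \<open>Events of bounded recursion depth\<close>

text \<open>For distinct vertices \<open>ws\<close>, the lists of length \<open>length ws\<close>
  encode the assignments on \<open>ws\<close>, in the order in which the loop makes them.\<close>

definition spin_lists :: "'v spin_system \<Rightarrow> nat \<Rightarrow> nat list set" where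
  "spin_lists S m = {js. set js \<subseteq> {1..nspins S} \<and> length js = m}"

lemma finite_spin_lists [simp]: "finite (spin_lists S m)"
  unfolding spin_lists_def by (rule finite_lists_length_eq) simp

lemma spin_lists_0: "spin_lists S 0 = {[]}"
  by (auto simp: spin_lists_def)

lemma sum_spin_lists_Suc:
  "(\<Sum>js\<in>spin_lists S (Suc m). g js) =
   (\<Sum>j\<in>{1..nspins S}. \<Sum>js\<in>spin_lists S m. g (j # js))"
proof -
  have "spin_lists S (Suc m) = (\<lambda>(j, js). j # js) ` ({1..nspins S} \<times> spin_lists S m)"
    by (auto simp: spin_lists_def length_Suc_conv image_iff)
  moreover have "inj_on (\<lambda>(j, js). j # js) ({1..nspins S} \<times> spin_lists S m)"
    by (auto simp: inj_on_def)
  ultimately show ?thesis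
    by (simp add: sum.reindex sum.cartesian_product split_def)
qed

text \<open>In \<open>loop_event a ws \<sigma> js B\<close>, the function \<open>a\<close> plays the role of a single call, \<open>js\<close> lists
  the spins assigned to \<open>ws\<close>, and \<open>B\<close> constrains the tape left over.\<close>

fun loop_event :: "(('v \<rightharpoonup> nat) \<Rightarrow> 'v \<Rightarrow> nat \<Rightarrow> real stream set \<Rightarrow> real stream set) \<Rightarrow>
    'v list \<Rightarrow> ('v \<rightharpoonup> nat) \<Rightarrow> nat list \<Rightarrow> real stream set \<Rightarrow> real stream set" where
  "loop_event a [] \<sigma> [] B = B"
| "loop_event a (w # ws) \<sigma> (j # js) B = a \<sigma> w j (loop_event a ws (\<sigma>(w \<mapsto> j)) js B)"
| "loop_event a _ \<sigma> _ B = {}"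

locale ssms_setting =
  fixes S :: "'v spin_system"
    and \<mu> :: "('v \<Rightarrow> nat) measure"
    and l :: nat
    and enum :: "('v \<rightharpoonup> nat) \<Rightarrow> 'v \<Rightarrow> 'v list"
  assumes gibbs: "gibbs_measure S \<mu>"
    and ordering: "sphere_ordering S l enum"
begin

sublocale prob_space \<mu>
  using gibbs by (simp add: gibbs_measure_def)

text \<open>The event that the call on \<open>\<sigma>\<close> and \<open>v\<close> halts within recursion depth \<open>n\<close> with spin \<open>i\<close>, leaving
  a tape in \<open>B\<close>. The parameter \<open>B\<close> encodes the independence of the unread tape: the bounds below
  carry the factor \<open>measure random_tape B\<close>.\<close>

primrec call_event :: "nat \<Rightarrow> ('v \<rightharpoonup> nat) \<Rightarrow> 'v \<Rightarrow> nat \<Rightarrow> real stream set \<Rightarrow> real stream set" where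
  "call_event 0 \<sigma> v i B = {}"
| "call_event (Suc n) \<sigma> v i B = cyl (I_int S \<mu> l \<sigma> v i) B \<union>
     (\<Union>js\<in>spin_lists S (length (enum \<sigma> v)).
        cyl (I_zero S \<mu> l \<sigma> v \<inter> J_int S \<mu> l \<sigma> (\<sigma>(enum \<sigma> v [\<mapsto>] js)) v i)
          (loop_event (call_event n) (enum \<sigma> v) \<sigma> js B))"

text \<open>Stated for arbitrary \<open>a\<close>, so that it applies to \<open>call_event n\<close>
  inside an induction on \<open>n\<close>.\<close>

lemma loop_event_sets:
  assumes "\<And>\<sigma> v i B. B \<in> sets random_tape \<Longrightarrow> a \<sigma> v i B \<in> sets random_tape"
    and "B \<in> sets random_tape"
  shows "loop_event a ws \<sigma> js B \<in> sets random_tape"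
proof (induction ws arbitrary: \<sigma> js)
  case Nil
  then show ?case using assms(2) by (cases js) auto
next
  case (Cons w ws)
  then show ?case by (cases js) (auto intro: assms(1))
qed

lemma call_event_sets:
  "B \<in> sets random_tape \<Longrightarrow> call_event n \<sigma> v i B \<in> sets random_tape"
proof (induction n arbitrary: \<sigma> v i B)
  case (Suc n)
  then show ?case
    by (auto intro!: sets.Un sets.finite_UN cyl_sets loop_event_sets
        simp: I_int_def I_zero_def J_int_def)
qed simp

text \<open>The event of the later calls is the last argument of \<open>a\<close> for the earlier
  one; hence the premise lets \<open>a\<close> and \<open>B\<close> grow at the same time.\<close>

lemma loop_event_mono:
  assumes "\<And>\<sigma> v i B B'. B \<subseteq> B' \<Longrightarrow> a \<sigma> v i B \<subseteq> a' \<sigma> v i B'" "B \<subseteq> B'"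
  shows "loop_event a ws \<sigma> js B \<subseteq> loop_event a' ws \<sigma> js B'"
  using assms by (induction a ws \<sigma> js B rule: loop_event.induct) simp_all

lemma call_event_mono:
  "n \<le> m \<Longrightarrow> B \<subseteq> B' \<Longrightarrow> call_event n \<sigma> v i B \<subseteq> call_event m \<sigma> v i B'"
proof (induction n arbitrary: m \<sigma> v i B B')
  case (Suc n)
  then obtain k where m: "m = Suc k" "n \<le> k"
    by (cases m) auto
  have "loop_event (call_event n) ws \<sigma> js B \<subseteq> loop_event (call_event k) ws \<sigma> js B'" for ws js
    by (rule loop_event_mono) (use Suc m in blast)+
  then show ?case
    using Suc.prems(2) unfolding m call_event.simps(2) cyl_def by blast
qed simp

section \<open>Halting runs and events of bounded depth\<close>

lemma ssms_imp_call_event: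
  "ssms S \<mu> l enum \<sigma> v s \<sigma>' s' \<Longrightarrow>
     \<exists>i\<in>{1..nspins S}. \<sigma>' = \<sigma>(v \<mapsto> i) \<and> (\<exists>n. \<forall>B. s' \<in> B \<longrightarrow> s \<in> call_event n \<sigma> v i B)"
  "ssms_loop S \<mu> l enum ws \<sigma> s \<sigma>' s' \<Longrightarrow>
     \<exists>js\<in>spin_lists S (length ws). \<sigma>' = \<sigma>(ws [\<mapsto>] js) \<and>
       (\<exists>n. \<forall>B. s' \<in> B \<longrightarrow> s \<in> loop_event (call_event n) ws \<sigma> js B)"
proof (induction rule: ssms_ssms_loop.inducts)
  case (direct i y \<sigma> v s)
  then have "\<forall>B. s \<in> B \<longrightarrow> y ## s \<in> call_event (Suc 0) \<sigma> v i B"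
    by (simp add: cyl_def)
  with direct(1) show ?case by blast
next
  case (recursive y \<sigma> v s \<sigma>' s' i)
  then obtain js n where *: "js \<in> spin_lists S (length (enum \<sigma> v))" "\<sigma>' = \<sigma>(enum \<sigma> v [\<mapsto>] js)"
    "\<forall>B. s' \<in> B \<longrightarrow> s \<in> loop_event (call_event n) (enum \<sigma> v) \<sigma> js B"
    by blast
  then have "\<forall>B. s' \<in> B \<longrightarrow> y ## s \<in> call_event (Suc n) \<sigma> v i B"
    using recursive(1,5) by (auto simp: cyl_def)
  with recursive(4) show ?case by blast
next
  case (loop_nil \<sigma> s)
  then show ?case by (simp add: spin_lists_0)
next
  case (loop_cons \<sigma> w s \<sigma>' s' ws \<sigma>'' s'')
  from loop_cons(2) obtain j n where
    1: "j \<in> {1..nspins S}" "\<sigma>' = \<sigma>(w \<mapsto> j)" "\<And>B. s' \<in> B \<Longrightarrow> s \<in> call_event n \<sigma> w j B"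
    by blast
  from loop_cons(4) obtain js m where
    2: "js \<in> spin_lists S (length ws)" "\<sigma>'' = \<sigma>'(ws [\<mapsto>] js)"
      "\<And>B. s'' \<in> B \<Longrightarrow> s' \<in> loop_event (call_event m) ws \<sigma>' js B"
    by blast
  \<comment> \<open>One depth has to serve the whole loop. The bound \<open>n\<close> was fixed
    before \<open>B\<close>, so it may be used below with a \<open>B\<close> that depends on
    \<open>?k\<close> and thereby on \<open>n\<close>.\<close>
  let ?k = "max n m"
  have "s \<in> loop_event (call_event ?k) (w # ws) \<sigma> (j # js) B" if "s'' \<in> B" for B
  proof -
    have "loop_event (call_event m) ws \<sigma>' js B \<subseteq> loop_event (call_event ?k) ws \<sigma>' js B"
      by (intro loop_event_mono call_event_mono) auto
    with 2(3)[OF that] have "s' \<in> loop_event (call_event ?k) ws \<sigma>' js B" by blast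
    then have "s \<in> call_event n \<sigma> w j (loop_event (call_event ?k) ws \<sigma>' js B)"
      by (rule 1(3))
    moreover have "call_event n \<sigma> w j C \<subseteq> call_event ?k \<sigma> w j C" for C
      by (rule call_event_mono) auto
    ultimately show ?thesis using 1(2) by auto
  qed
  moreover have "j # js \<in> spin_lists S (length (w # ws))" "\<sigma>'' = \<sigma>(w # ws [\<mapsto>] j # js)"
    using 1 2 by (auto simp: spin_lists_def)
  ultimately show ?case by blast
qed

text \<open>The premise on \<open>a\<close> is what the induction hypothesis of
  \<open>call_event_imp_ssms\<close> provides for \<open>call_event n\<close>.\<close>

lemma loop_event_imp_ssms_loop:
  assumes "\<And>\<sigma> v i s B. s \<in> a \<sigma> v i B \<Longrightarrow> i \<in> {1..nspins S} \<Longrightarrow>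
      \<exists>s'\<in>B. ssms S \<mu> l enum \<sigma> v s (\<sigma>(v \<mapsto> i)) s'"
    and "s \<in> loop_event a ws \<sigma> js B" "set js \<subseteq> {1..nspins S}"
  shows "\<exists>s'\<in>B. ssms_loop S \<mu> l enum ws \<sigma> s (\<sigma>(ws [\<mapsto>] js)) s'"
  using assms
proof (induction a ws \<sigma> js B arbitrary: s rule: loop_event.induct)
  case (1 a \<sigma> B)
  then show ?case by (auto intro: loop_nil)
next
  case (2 a w ws \<sigma> j js B)
  from 2(3,4) have "s \<in> a \<sigma> w j (loop_event a ws (\<sigma>(w \<mapsto> j)) js B)" "j \<in> {1..nspins S}"
    by auto
  \<comment> \<open>The tape set of the first call is the event of the remaining loop, so
    \<open>s1\<close> is a tape on which that loop can be continued.\<close>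
  from 2(2)[OF this] obtain s1 where s1: "s1 \<in> loop_event a ws (\<sigma>(w \<mapsto> j)) js B"
      "ssms S \<mu> l enum \<sigma> w s (\<sigma>(w \<mapsto> j)) s1"
    by (rule bexE)
  from 2(4) have "set js \<subseteq> {1..nspins S}" by simp
  from 2(1)[OF 2(2) s1(1) this] obtain s2 where
    "s2 \<in> B" "ssms_loop S \<mu> l enum ws (\<sigma>(w \<mapsto> j)) s1 (\<sigma>(w # ws [\<mapsto>] j # js)) s2"
    unfolding map_upds_Cons by (rule bexE)
  with loop_cons[OF s1(2)] show ?case by blast
qed auto

lemma call_event_imp_ssms:
  "s \<in> call_event n \<sigma> v i B \<Longrightarrow> i \<in> {1..nspins S} \<Longrightarrow>
     \<exists>s'\<in>B. ssms S \<mu> l enum \<sigma> v s (\<sigma>(v \<mapsto> i)) s'"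
proof (induction n arbitrary: \<sigma> v i s B)
  case (Suc n)
  obtain y t where s: "s = y ## t" by (cases s)
  consider "y \<in> I_int S \<mu> l \<sigma> v i" "t \<in> B"
    | js where "js \<in> spin_lists S (length (enum \<sigma> v))" "y \<in> I_zero S \<mu> l \<sigma> v"
      "y \<in> J_int S \<mu> l \<sigma> (\<sigma>(enum \<sigma> v [\<mapsto>] js)) v i"
      "t \<in> loop_event (call_event n) (enum \<sigma> v) \<sigma> js B"
    using Suc.prems(1) by (auto simp: cyl_def s)
  then show ?case
  proof cases
    case 1
    with direct[OF Suc.prems(2)] show ?thesis unfolding s by blast
  next
    case (2 js)
    from 2(1) have "set js \<subseteq> {1..nspins S}" by (simp add: spin_lists_def)
    from loop_event_imp_ssms_loop[OF Suc.IH 2(4) this] obtain s' where "s' \<in> B"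
      "ssms_loop S \<mu> l enum (enum \<sigma> v) \<sigma> t (\<sigma>(enum \<sigma> v [\<mapsto>] js)) s'"
      by blast
    with recursive[OF 2(2) _ Suc.prems(2) 2(3)] show ?thesis unfolding s by blast
  qed
qed simp

text \<open>A halting run has finite depth, so the event is a countable union. This yields its
  measurability and makes its probability a limit of those of the bounded events.\<close>

lemma assign_event_eq:
  assumes "i \<in> {1..nspins S}"
  shows "{s. \<exists>\<sigma>' s'. ssms S \<mu> l enum \<sigma> v s \<sigma>' s' \<and> \<sigma>' v = Some i} =
    (\<Union>n. call_event n \<sigma> v i UNIV)"
proof (intro set_eqI iffI)
  fix s assume "s \<in> {s. \<exists>\<sigma>' s'. ssms S \<mu> l enum \<sigma> v s \<sigma>' s' \<and> \<sigma>' v = Some i}"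
  then obtain \<sigma>' s' where *: "ssms S \<mu> l enum \<sigma> v s \<sigma>' s'" "\<sigma>' v = Some i"
    by blast
  from ssms_imp_call_event(1)[OF *(1)] *(2) obtain n where "s \<in> call_event n \<sigma> v i UNIV"
    by auto
  then show "s \<in> (\<Union>n. call_event n \<sigma> v i UNIV)"
    by blast
next
  fix s assume "s \<in> (\<Union>n. call_event n \<sigma> v i UNIV)"
  then obtain s' where "ssms S \<mu> l enum \<sigma> v s (\<sigma>(v \<mapsto> i)) s'"
    using call_event_imp_ssms assms by blast
  moreover have "(\<sigma>(v \<mapsto> i)) v = Some i" by simp
  ultimately show "s \<in> {s. \<exists>\<sigma>' s'. ssms S \<mu> l enum \<sigma> v s \<sigma>' s' \<and> \<sigma>' v = Some i}"
    by blast
qed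

text \<open>Every output carries an admissible spin at \<open>v\<close>; this reduces termination to
  finitely many assignment events.\<close>

lemma termination_event_eq:
  "{s. \<exists>\<sigma>' s'. ssms S \<mu> l enum \<sigma> v s \<sigma>' s'} =
    (\<Union>i\<in>{1..nspins S}. {s. \<exists>\<sigma>' s'. ssms S \<mu> l enum \<sigma> v s \<sigma>' s' \<and> \<sigma>' v = Some i})"
proof -
  have "\<exists>i\<in>{1..nspins S}. \<sigma>' v = Some i" if "ssms S \<mu> l enum \<sigma> v s \<sigma>' s'" for s \<sigma>' s'
    using ssms_imp_call_event(1)[OF that] by auto
  then show ?thesis by blast
qed

section \<open>Conditional marginals\<close>

lemma spin_range:
  assumes "x \<in> verts S" "\<eta> \<in> space \<mu>"
  shows "\<eta> x \<in> {1..nspins S}"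
proof -
  have "space \<mu> = space (\<Pi>\<^sub>M v\<in>verts S. count_space {1..nspins S})"
    using gibbs by (intro sets_eq_imp_space_eq) (simp add: gibbs_measure_def)
  then show ?thesis using assms by (auto simp: space_PiM)
qed

lemma spin_sets:
  assumes "x \<in> verts S"
  shows "{\<eta> \<in> space \<mu>. \<eta> x = j} \<in> events"
proof -
  have "sets \<mu> = sets (\<Pi>\<^sub>M v\<in>verts S. count_space {1..nspins S})"
    using gibbs by (simp add: gibbs_measure_def)
  then have "(\<lambda>\<eta>. \<eta> x) \<in> \<mu> \<rightarrow>\<^sub>M count_space {1..nspins S}"
    using measurable_component_singleton[OF assms, of "\<lambda>_. count_space {1..nspins S}"]
    by (metis measurable_cong_sets)
  \<comment> \<open>The intersection makes \<open>{j}\<close> a set of the count space for every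
    \<open>j\<close>; by \<open>spin_range\<close> the preimage does not change.\<close>
  then have "(\<lambda>\<eta>. \<eta> x) -` ({j} \<inter> {1..nspins S}) \<inter> space \<mu> \<in> events"
    by (rule measurable_sets) simp
  moreover have "(\<lambda>\<eta>. \<eta> x) -` ({j} \<inter> {1..nspins S}) \<inter> space \<mu> = {\<eta> \<in> space \<mu>. \<eta> x = j}"
    using spin_range[OF assms] by blast
  ultimately show ?thesis by simp
qed

lemma agrees_sets:
  assumes "finite (dom \<sigma>)" "dom \<sigma> \<subseteq> verts S"
  shows "{\<eta> \<in> space \<mu>. agrees \<eta> \<sigma>} \<in> events"
proof -
  have "{\<eta> \<in> space \<mu>. \<forall>x\<in>dom \<sigma>. \<eta> x = the (\<sigma> x)} \<in> events"
    using assms by (intro sets.sets_Collect_finite_All' sets.sets_Collect_finite_All spin_sets) auto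
  moreover have "agrees \<eta> \<sigma> \<longleftrightarrow> (\<forall>x\<in>dom \<sigma>. \<eta> x = the (\<sigma> x))" for \<eta>
    unfolding agrees_def by (intro ball_cong) auto
  ultimately show ?thesis by simp
qed

section \<open>Joint probabilities and summation over spins\<close>

lemma agrees_upd:
  "w \<notin> dom \<sigma> \<Longrightarrow> agrees \<eta> (\<sigma>(w \<mapsto> j)) \<longleftrightarrow> \<eta> w = j \<and> agrees \<eta> \<sigma>"
  by (auto simp: agrees_def)

text \<open>One notion covers marginals, with \<open>E\<close> the whole space, and numerators of
  conditional marginals, with \<open>E\<close> fixing the spin at \<open>v\<close>; the summation
  rules then serve both.\<close>

definition joint :: "('v \<Rightarrow> nat) set \<Rightarrow> ('v \<rightharpoonup> nat) \<Rightarrow> real" where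
  "joint E \<sigma> = prob (E \<inter> {\<eta> \<in> space \<mu>. agrees \<eta> \<sigma>})"

lemma marg_prob_eq_joint: "marg_prob \<mu> \<sigma> = joint (space \<mu>) \<sigma>"
  unfolding marg_prob_def joint_def by (rule arg_cong[where f=prob]) auto

lemma cond_marg_eq_joint:
  "cond_marg \<mu> \<sigma> v i = joint {\<eta> \<in> space \<mu>. \<eta> v = i} \<sigma> / marg_prob \<mu> \<sigma>"
  unfolding cond_marg_def cond_prob_def marg_prob_def joint_def
  by (intro arg_cong2[where f="(/)"] arg_cong[where f=prob]) auto

lemma cond_marg_eq_marg_prob:
  "v \<notin> dom \<sigma> \<Longrightarrow> cond_marg \<mu> \<sigma> v i = marg_prob \<mu> (\<sigma>(v \<mapsto> i)) / marg_prob \<mu> \<sigma>"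
  by (simp add: cond_marg_def cond_prob_def marg_prob_def agrees_upd)

lemma marg_prob_nonneg: "0 \<le> marg_prob \<mu> \<sigma>"
  by (simp add: marg_prob_def)

lemma cond_marg_nonneg: "0 \<le> cond_marg \<mu> \<sigma> v i"
  by (simp add: cond_marg_eq_joint joint_def marg_prob_nonneg)

text \<open>In product form the identity survives marginal probability 0, because the joint event
  lies in the null event. It also allows \<open>v\<close> in the domain, as happens after the loop
  for \<open>l = 0\<close>, where the sphere is \<open>v\<close> itself.\<close>

lemma cond_marg_mult_marg_prob:
  assumes "finite (dom \<sigma>)" "dom \<sigma> \<subseteq> verts S"
  shows "cond_marg \<mu> \<sigma> v i * marg_prob \<mu> \<sigma> = joint {\<eta> \<in> space \<mu>. \<eta> v = i} \<sigma>"
proof (cases "marg_prob \<mu> \<sigma> = 0")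
  case True
  have "joint {\<eta> \<in> space \<mu>. \<eta> v = i} \<sigma> \<le> marg_prob \<mu> \<sigma>"
    unfolding joint_def marg_prob_def
    by (rule finite_measure_mono) (use agrees_sets[OF assms] in auto)
  with True show ?thesis by (simp add: joint_def measure_le_0_iff)
qed (simp add: cond_marg_eq_joint)

text \<open>Total probability: the spin at \<open>w\<close> partitions the event, and
  \<open>spin_range\<close> leaves only the values in \<open>{1..nspins S}\<close>.\<close>

lemma sum_joint_upd:
  assumes "E \<in> events" "finite (dom \<sigma>)" "dom \<sigma> \<subseteq> verts S" "w \<in> verts S - dom \<sigma>"
  shows "(\<Sum>j\<in>{1..nspins S}. joint E (\<sigma>(w \<mapsto> j))) = joint E \<sigma>"
proof -
  let ?A = "\<lambda>j. E \<inter> {\<eta> \<in> space \<mu>. agrees \<eta> (\<sigma>(w \<mapsto> j))}"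
  have "(\<Sum>j\<in>{1..nspins S}. prob (?A j)) = prob (\<Union>j\<in>{1..nspins S}. ?A j)"
  proof (rule finite_measure_finite_Union[symmetric])
    show "?A ` {1..nspins S} \<subseteq> events"
      using assms by (intro image_subsetI sets.Int agrees_sets) simp_all
    show "disjoint_family_on ?A {1..nspins S}"
      using assms(4) by (auto simp: disjoint_family_on_def agrees_upd)
  qed simp
  also have "(\<Union>j\<in>{1..nspins S}. ?A j) = E \<inter> {\<eta> \<in> space \<mu>. agrees \<eta> \<sigma>}"
    using assms(4) spin_range[of w] by (auto simp: agrees_upd)
  finally show ?thesis unfolding joint_def .
qed

text \<open>Total probability one vertex at a time; distinctness keeps each vertex of
  \<open>ws\<close> outside the domain until it gets its spin.\<close>

lemma sum_joint_spin_lists: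
  assumes "E \<in> events" "finite (dom \<sigma>)" "dom \<sigma> \<subseteq> verts S" "distinct ws"
    "set ws \<subseteq> verts S - dom \<sigma>"
  shows "(\<Sum>js\<in>spin_lists S (length ws). joint E (\<sigma>(ws [\<mapsto>] js))) = joint E \<sigma>"
  using assms
proof (induction ws arbitrary: \<sigma>)
  case Nil
  then show ?case by (simp add: spin_lists_0)
next
  case (Cons w ws)
  have "(\<Sum>js\<in>spin_lists S (length (w # ws)). joint E (\<sigma>(w # ws [\<mapsto>] js))) =
      (\<Sum>j\<in>{1..nspins S}. \<Sum>js\<in>spin_lists S (length ws). joint E (\<sigma>(w \<mapsto> j, ws [\<mapsto>] js)))"
    by (simp add: sum_spin_lists_Suc)
  also have "\<dots> = (\<Sum>j\<in>{1..nspins S}. joint E (\<sigma>(w \<mapsto> j)))"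
  proof (rule sum.cong[OF refl])
    fix j
    show "(\<Sum>js\<in>spin_lists S (length ws). joint E (\<sigma>(w \<mapsto> j, ws [\<mapsto>] js))) = joint E (\<sigma>(w \<mapsto> j))"
      by (rule Cons.IH) (use Cons.prems in \<open>auto simp del: fun_upd_apply\<close>)
  qed
  also have "\<dots> = joint E \<sigma>"
    by (rule sum_joint_upd) (use Cons.prems in auto)
  finally show ?case .
qed

lemma sum_cond_marg:
  assumes "finite (dom \<sigma>)" "dom \<sigma> \<subseteq> verts S" "v \<in> verts S - dom \<sigma>" "0 < marg_prob \<mu> \<sigma>"
  shows "(\<Sum>i\<in>{1..nspins S}. cond_marg \<mu> \<sigma> v i) = 1"
  using assms sum_joint_upd[of "space \<mu>" \<sigma> v]
  by (simp add: cond_marg_eq_marg_prob marg_prob_eq_joint flip: sum_divide_distrib)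

text \<open>Feasibility with respect to the fixed \<mu>, whereas \<open>feasible\<close> asks for
  some Gibbs measure. Positive probability already forces admissible spins.\<close>

definition feasible_config :: "('v \<rightharpoonup> nat) \<Rightarrow> bool" where
  "feasible_config \<sigma> \<longleftrightarrow> finite (dom \<sigma>) \<and> dom \<sigma> \<subseteq> verts S \<and> 0 < marg_prob \<mu> \<sigma>"

lemma
  assumes "v \<in> verts S"
  shows distinct_enum: "distinct (enum \<sigma> v)"
    and set_enum: "set (enum \<sigma> v) = gsphere S l v - dom \<sigma>"
    and set_enum_subset: "set (enum \<sigma> v) \<subseteq> verts S - dom \<sigma>"
  using ordering assms by (auto simp: sphere_ordering_def gsphere_def)

section \<open>The minima over sphere configurations\<close>

lemma map_upds_in_configs:
  assumes "length js = length ws" "set js \<subseteq> {1..nspins S}"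
  shows "Map.empty(ws [\<mapsto>] js) \<in> configs S (set ws)"
proof -
  have "ran (map_of (rev (zip ws js))) \<subseteq> set js"
    by (auto simp: ran_def dest!: map_of_SomeD set_zip_rightD)
  then show ?thesis
    using assms by (simp add: configs_def map_upds_def dom_map_of_conv_image_fst flip: set_map)
qed

text \<open>\<open>P i\<close> is the set minimised in \<open>p_low\<close>. It is finite because
  the list \<open>enum \<sigma> v\<close> exhausts the unassigned sphere.\<close>

lemma p_low_candidates:
  fixes \<sigma> :: "'v \<rightharpoonup> nat"
  assumes "v \<in> verts S"
  defines "P \<equiv> \<lambda>i. {cond_marg \<mu> (\<sigma> ++ \<tau>) v i | \<tau>.
      \<tau> \<in> configs S (gsphere S l v - dom \<sigma>) \<and> 0 < marg_prob \<mu> (\<sigma> ++ \<tau>)}"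
  shows "finite (P i)"
    and "js \<in> spin_lists S (length (enum \<sigma> v)) \<Longrightarrow> 0 < marg_prob \<mu> (\<sigma>(enum \<sigma> v [\<mapsto>] js)) \<Longrightarrow>
      cond_marg \<mu> (\<sigma>(enum \<sigma> v [\<mapsto>] js)) v i \<in> P i"
proof -
  have "finite (configs S (set (enum \<sigma> v)))"
    unfolding configs_def by (rule finite_set_of_finite_maps) auto
  then show "finite (P i)"
    unfolding P_def set_enum[OF assms(1)] by simp
  assume js: "js \<in> spin_lists S (length (enum \<sigma> v))" "0 < marg_prob \<mu> (\<sigma>(enum \<sigma> v [\<mapsto>] js))"
  then have "Map.empty(enum \<sigma> v [\<mapsto>] js) \<in> configs S (gsphere S l v - dom \<sigma>)"
    using map_upds_in_configs[of js "enum \<sigma> v"] set_enum[OF assms(1)] by (simp add: spin_lists_def)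
  moreover have "\<sigma>(enum \<sigma> v [\<mapsto>] js) = \<sigma> ++ Map.empty(enum \<sigma> v [\<mapsto>] js)"
    by simp
  ultimately show "cond_marg \<mu> (\<sigma>(enum \<sigma> v [\<mapsto>] js)) v i \<in> P i"
    using js(2) unfolding P_def by (intro CollectI exI[of _ "Map.empty(enum \<sigma> v [\<mapsto>] js)"]) auto
qed

lemma p_low_le:
  assumes "v \<in> verts S" "js \<in> spin_lists S (length (enum \<sigma> v))"
    "0 < marg_prob \<mu> (\<sigma>(enum \<sigma> v [\<mapsto>] js))"
  shows "p_low S \<mu> l \<sigma> v i \<le> cond_marg \<mu> (\<sigma>(enum \<sigma> v [\<mapsto>] js)) v i"
  unfolding p_low_def by (intro Min_le p_low_candidates assms)

text \<open>The minimum must range over a nonempty set, so some extension to the sphere has to be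
  feasible. It exists because the probabilities of the extensions sum to the positive number
  \<open>marg_prob \<mu> \<sigma>\<close>.\<close>

lemma p_low_nonneg:
  assumes "feasible_config \<sigma>" "v \<in> verts S"
  shows "0 \<le> p_low S \<mu> l \<sigma> v i"
proof -
  have "(\<Sum>js\<in>spin_lists S (length (enum \<sigma> v)). marg_prob \<mu> (\<sigma>(enum \<sigma> v [\<mapsto>] js))) =
      marg_prob \<mu> \<sigma>"
    unfolding marg_prob_eq_joint
    by (rule sum_joint_spin_lists)
       (use assms distinct_enum set_enum_subset in \<open>auto simp: feasible_config_def\<close>)
  then have "\<exists>js\<in>spin_lists S (length (enum \<sigma> v)). 0 < marg_prob \<mu> (\<sigma>(enum \<sigma> v [\<mapsto>] js))"
    using assms(1) sum_nonpos[of "spin_lists S (length (enum \<sigma> v))"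
        "\<lambda>js. marg_prob \<mu> (\<sigma>(enum \<sigma> v [\<mapsto>] js))"]
    by (force simp: feasible_config_def)
  then obtain js where js: "js \<in> spin_lists S (length (enum \<sigma> v))"
      "0 < marg_prob \<mu> (\<sigma>(enum \<sigma> v [\<mapsto>] js))"
    by blast
  show ?thesis
    unfolding p_low_def
  proof (rule Min.boundedI)
    show "{cond_marg \<mu> (\<sigma> ++ \<tau>) v i | \<tau>. \<tau> \<in> configs S (gsphere S l v - dom \<sigma>) \<and>
        0 < marg_prob \<mu> (\<sigma> ++ \<tau>)} \<noteq> {}"
      using p_low_candidates(2)[OF assms(2) js] by blast
  qed (use p_low_candidates(1)[OF assms(2)] cond_marg_nonneg in auto)
qed

section \<open>Bounds for the output probabilities\<close>

text \<open>The conditional probabilities of the successive spins multiply to a telescoping product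
  of marginals. Since \<open>le\<close> holds for every \<open>B\<close>, it can be applied to one
  call with the event of the later calls as \<open>B\<close>.\<close>

lemma loop_event_le:
  assumes sets: "\<And>\<sigma> v i B. B \<in> sets random_tape \<Longrightarrow> a \<sigma> v i B \<in> sets random_tape"
    and le: "\<And>\<sigma> v i B. B \<in> sets random_tape \<Longrightarrow> feasible_config \<sigma> \<Longrightarrow> v \<in> verts S - dom \<sigma> \<Longrightarrow>
      i \<in> {1..nspins S} \<Longrightarrow>
      measure random_tape (a \<sigma> v i B) \<le> cond_marg \<mu> \<sigma> v i * measure random_tape B"
    and B: "B \<in> sets random_tape"
    and "feasible_config \<sigma>" "distinct ws" "set ws \<subseteq> verts S - dom \<sigma>"
      "js \<in> spin_lists S (length ws)"
  shows "measure random_tape (loop_event a ws \<sigma> js B) \<le>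
    marg_prob \<mu> (\<sigma>(ws [\<mapsto>] js)) / marg_prob \<mu> \<sigma> * measure random_tape B"
  using assms(4-)
proof (induction ws arbitrary: \<sigma> js)
  case Nil
  then show ?case by (simp add: spin_lists_0 feasible_config_def)
next
  case (Cons w ws)
  then obtain j js' where js: "js = j # js'" "j \<in> {1..nspins S}" "js' \<in> spin_lists S (length ws)"
    by (cases js) (auto simp: spin_lists_def)
  let ?\<sigma> = "\<sigma>(w \<mapsto> j)"
  let ?C = "loop_event a ws ?\<sigma> js' B"
  have w: "w \<in> verts S - dom \<sigma>" using Cons.prems(3) by simp
  have "measure random_tape (a \<sigma> w j ?C) \<le> cond_marg \<mu> \<sigma> w j * measure random_tape ?C"
    using Cons.prems js w by (intro le loop_event_sets sets B)
  also have "\<dots> \<le> marg_prob \<mu> (?\<sigma>(ws [\<mapsto>] js')) / marg_prob \<mu> \<sigma> * measure random_tape B"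
  \<comment> \<open>The induction hypothesis needs a feasible configuration. If the extension by
    \<open>j\<close> has probability 0, the factor \<open>cond_marg\<close> vanishes
    instead.\<close>
  proof (cases "marg_prob \<mu> ?\<sigma> = 0")
    case True
    then show ?thesis
      using w by (simp add: cond_marg_eq_marg_prob marg_prob_nonneg)
  next
    case False
    have "feasible_config ?\<sigma>"
      using False Cons.prems(1) w marg_prob_nonneg[of ?\<sigma>] by (simp add: feasible_config_def)
    then have "measure random_tape ?C \<le>
        marg_prob \<mu> (?\<sigma>(ws [\<mapsto>] js')) / marg_prob \<mu> ?\<sigma> * measure random_tape B"
      by (rule Cons.IH) (use Cons.prems js in \<open>auto simp del: fun_upd_apply\<close>)
    from mult_left_mono[OF this cond_marg_nonneg[of \<sigma> w j]] show ?thesis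
      using False w by (simp add: cond_marg_eq_marg_prob)
  qed
  finally show ?case by (simp add: js)
qed

lemma call_event_le:
  assumes "B \<in> sets random_tape" "feasible_config \<sigma>" "v \<in> verts S - dom \<sigma>" "i \<in> {1..nspins S}"
  shows "measure random_tape (call_event n \<sigma> v i B) \<le> cond_marg \<mu> \<sigma> v i * measure random_tape B"
  using assms
proof (induction n arbitrary: \<sigma> v i B)
  case 0
  then show ?case by (simp add: cond_marg_nonneg)
next
  case (Suc n)
  interpret T: prob_space random_tape by (rule prob_space_random_tape)
  let ?ws = "enum \<sigma> v" and ?p = "p_low S \<mu> l \<sigma> v i" and ?b = "measure random_tape B"
  let ?Js = "spin_lists S (length ?ws)"
  let ?\<sigma> = "\<lambda>js. \<sigma>(?ws [\<mapsto>] js)" and ?m = "marg_prob \<mu> \<sigma>"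
  let ?I = "\<lambda>js. I_zero S \<mu> l \<sigma> v \<inter> J_int S \<mu> l \<sigma> (?\<sigma> js) v i"
  let ?L = "\<lambda>js. loop_event (call_event n) ?ws \<sigma> js B"
  have v: "v \<in> verts S" and m: "0 < ?m" and dom: "finite (dom \<sigma>)" "dom \<sigma> \<subseteq> verts S"
    using Suc.prems by (auto simp: feasible_config_def)
  note ws = distinct_enum[OF v] set_enum_subset[OF v]
  \<comment> \<open>Splitting off the last summand shows the lengths of \<open>I_int\<close> and
    \<open>J_int\<close> to be \<open>p_low\<close> and \<open>rho\<close>.\<close>
  have i: "{1..i} = insert i {1..<i}" using Suc.prems(4) by auto
  have L: "?L js \<in> sets random_tape" for js
    by (intro loop_event_sets call_event_sets Suc.prems(1))
  have C: "cyl (?I js) (?L js) \<in> sets random_tape" for js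
    by (intro cyl_sets L) (simp add: I_zero_def J_int_def)
  have bound: "measure random_tape (cyl (?I js) (?L js)) \<le>
      (joint {\<eta> \<in> space \<mu>. \<eta> v = i} (?\<sigma> js) - ?p * marg_prob \<mu> (?\<sigma> js)) / ?m * ?b"
    if js: "js \<in> ?Js" for js
  proof -
    let ?r = "cond_marg \<mu> (?\<sigma> js) v i - ?p"
    have dom': "finite (dom (?\<sigma> js))" "dom (?\<sigma> js) \<subseteq> verts S"
      using dom ws(2)[of \<sigma>] js by (auto simp: spin_lists_def)
    have "measure random_tape (?L js) \<le> marg_prob \<mu> (?\<sigma> js) / ?m * ?b"
      by (intro loop_event_le call_event_sets Suc ws js)
    then have le: "measure (uniform_measure lborel {0..1}) (?I js) * measure random_tape (?L js) \<le>
        measure (uniform_measure lborel {0..1}) (?I js) * (marg_prob \<mu> (?\<sigma> js) / ?m * ?b)"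
      by (rule mult_left_mono) simp
    also have "\<dots> \<le> ?r * (marg_prob \<mu> (?\<sigma> js) / ?m * ?b)"
    \<comment> \<open>For an extension of probability 0, \<open>?r\<close> may be negative, but both
      sides vanish. Otherwise the minimum \<open>?p\<close> includes this extension, so
      \<open>?r\<close> is a genuine length.\<close>
    proof (cases "marg_prob \<mu> (?\<sigma> js) = 0")
      case False
      then have r: "0 \<le> ?r"
        using p_low_le[OF v js, of i] marg_prob_nonneg[of "?\<sigma> js"] by simp
      interpret U: prob_space "uniform_measure lborel {0..1::real}" by (rule prob_space_unit)
      let ?a = "(\<Sum>j\<in>{1..nspins S}. p_low S \<mu> l \<sigma> v j) +
        (\<Sum>k\<in>{1..<i}. rho S \<mu> l \<sigma> (?\<sigma> js) v k)"
      have "J_int S \<mu> l \<sigma> (?\<sigma> js) v i = {?a..<?a + ?r}"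
        unfolding J_int_def i by (simp add: rho_def algebra_simps)
      then have "U.prob (?I js) \<le> U.prob {?a..<?a + ?r}"
        by (intro U.finite_measure_mono) auto
      also have "\<dots> \<le> ?r" using measure_unit_interval_le[of ?a "?a + ?r"] r by simp
      finally show ?thesis
        using m marg_prob_nonneg by (intro mult_right_mono) auto
    qed simp
    \<comment> \<open>Multiplying out turns the conditional marginal into a joint probability, which
      can be summed over the extensions.\<close>
    also have "\<dots> = (cond_marg \<mu> (?\<sigma> js) v i * marg_prob \<mu> (?\<sigma> js) - ?p * marg_prob \<mu> (?\<sigma> js)) / ?m * ?b"
      by (simp add: algebra_simps diff_divide_distrib)
    finally show ?thesis
      by (subst measure_cyl) (use L dom' in \<open>simp_all add: cond_marg_mult_marg_prob I_zero_def J_int_def\<close>)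
  qed
  have I: "I_int S \<mu> l \<sigma> v i \<in> sets borel"
    by (simp add: I_int_def)
  have direct: "measure random_tape (cyl (I_int S \<mu> l \<sigma> v i) B) \<le> ?p * ?b"
  proof -
    let ?a = "\<Sum>j\<in>{1..<i}. p_low S \<mu> l \<sigma> v j"
    have "I_int S \<mu> l \<sigma> v i = {?a..<?a + ?p}"
      unfolding I_int_def i by (simp add: algebra_simps)
    then show ?thesis
      using measure_unit_interval_le[of ?a "?a + ?p"] p_low_nonneg[OF Suc.prems(2) v]
      by (subst measure_cyl[OF I Suc.prems(1)]) (auto intro!: mult_right_mono)
  qed
  have "measure random_tape (call_event (Suc n) \<sigma> v i B) \<le>
      measure random_tape (cyl (I_int S \<mu> l \<sigma> v i) B) +
      measure random_tape (\<Union>js\<in>?Js. cyl (?I js) (?L js))"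
    unfolding call_event.simps(2)
    by (rule measure_Un_le) (use C cyl_sets[OF I Suc.prems(1)] in auto)
  also have "\<dots> \<le> ?p * ?b + (\<Sum>js\<in>?Js. measure random_tape (cyl (?I js) (?L js)))"
    by (intro add_mono direct T.finite_measure_subadditive_finite) (use C in auto)
  also have "\<dots> \<le> ?p * ?b + (\<Sum>js\<in>?Js.
      (joint {\<eta> \<in> space \<mu>. \<eta> v = i} (?\<sigma> js) - ?p * marg_prob \<mu> (?\<sigma> js)) / ?m * ?b)"
    by (intro add_left_mono sum_mono bound)
  also have "\<dots> = ?p * ?b + ((\<Sum>js\<in>?Js. joint {\<eta> \<in> space \<mu>. \<eta> v = i} (?\<sigma> js)) -
      ?p * (\<Sum>js\<in>?Js. marg_prob \<mu> (?\<sigma> js))) / ?m * ?b"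
    by (simp add: sum_subtractf sum_distrib_left flip: sum_divide_distrib sum_distrib_right)
  also have "(\<Sum>js\<in>?Js. joint {\<eta> \<in> space \<mu>. \<eta> v = i} (?\<sigma> js)) = joint {\<eta> \<in> space \<mu>. \<eta> v = i} \<sigma>"
    by (intro sum_joint_spin_lists spin_sets v dom ws)
  also have "(\<Sum>js\<in>?Js. marg_prob \<mu> (?\<sigma> js)) = ?m"
    unfolding marg_prob_eq_joint by (intro sum_joint_spin_lists sets.top dom ws)
  \<comment> \<open>The sums over the sphere have collapsed to the values at \<sigma>, so the
    \<open>?p\<close> subtracted in the recursive part cancels the direct one.\<close>
  also have "?p * ?b + (joint {\<eta> \<in> space \<mu>. \<eta> v = i} \<sigma> - ?p * ?m) / ?m * ?b =
      cond_marg \<mu> \<sigma> v i * ?b"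
    using m by (simp add: cond_marg_eq_joint field_simps)
  finally show ?case .
qed

section \<open>Limit in the depth and comparison of total masses\<close>

lemma assign_event_sets:
  assumes "i \<in> {1..nspins S}"
  shows "{s. \<exists>\<sigma>' s'. ssms S \<mu> l enum \<sigma> v s \<sigma>' s' \<and> \<sigma>' v = Some i} \<in> sets random_tape"
  unfolding assign_event_eq[OF assms]
  by (intro sets.countable_UN) (auto intro: call_event_sets sets.top[of random_tape, simplified])

text \<open>Continuity from below in the depth; the tape left over is unconstrained, so the factor
  for \<open>B\<close> is 1.\<close>

lemma assign_prob_le:
  assumes "feasible_config \<sigma>" "v \<in> verts S - dom \<sigma>" "i \<in> {1..nspins S}"
  shows "assign_prob S \<mu> l enum \<sigma> v i \<le> cond_marg \<mu> \<sigma> v i"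
proof -
  interpret T: prob_space random_tape by (rule prob_space_random_tape)
  have UNIV: "UNIV \<in> sets random_tape" using sets.top[of random_tape] by simp
  have "(\<lambda>n. measure random_tape (call_event n \<sigma> v i UNIV))
      \<longlonglongrightarrow> measure random_tape (\<Union>n. call_event n \<sigma> v i UNIV)"
    by (intro T.finite_Lim_measure_incseq)
       (auto simp: incseq_def call_event_sets[OF UNIV] intro: call_event_mono[THEN subsetD])
  moreover have "measure random_tape (call_event n \<sigma> v i UNIV) \<le> cond_marg \<mu> \<sigma> v i" for n
    using call_event_le[OF UNIV assms] T.prob_space by simp
  ultimately show ?thesis
    using assign_event_eq[OF assms(3), of \<sigma> v]
    by (auto simp: assign_prob_def intro: LIMSEQ_le_const2)
qed

lemma termination_prob_le_sum:
  "termination_prob S \<mu> l enum \<sigma> v \<le> (\<Sum>i\<in>{1..nspins S}. assign_prob S \<mu> l enum \<sigma> v i)"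
proof -
  interpret T: prob_space random_tape by (rule prob_space_random_tape)
  show ?thesis
    unfolding termination_prob_def assign_prob_def
    using T.finite_measure_subadditive_finite[of "{1..nspins S}"
        "\<lambda>i. {s. \<exists>\<sigma>' s'. ssms S \<mu> l enum \<sigma> v s \<sigma>' s' \<and> \<sigma>' v = Some i}"] assign_event_sets
    by (simp add: termination_event_eq image_subset_iff)
qed

lemma assign_prob_eq:
  assumes "feasible_config \<sigma>" "v \<in> verts S - dom \<sigma>" "i \<in> {1..nspins S}"
    and halts: "termination_prob S \<mu> l enum \<sigma> v = 1"
  shows "assign_prob S \<mu> l enum \<sigma> v i = cond_marg \<mu> \<sigma> v i"
proof -
  let ?a = "assign_prob S \<mu> l enum \<sigma> v" and ?c = "cond_marg \<mu> \<sigma> v"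
  have nonneg: "0 \<le> ?c j - ?a j" if "j \<in> {1..nspins S}" for j
    using assign_prob_le[OF assms(1,2) that] by simp
  \<comment> \<open>The conditional marginals sum to 1 and, by almost sure termination, the
    assignment probabilities to at least 1. The nonnegative deficits must therefore all
    vanish.\<close>
  have "(\<Sum>j\<in>{1..nspins S}. ?c j - ?a j) \<le> 0"
    using termination_prob_le_sum[of \<sigma> v] sum_cond_marg[of \<sigma> v] assms(1,2) halts
    by (simp add: sum_subtractf feasible_config_def)
  then have "(\<Sum>j\<in>{1..nspins S}. ?c j - ?a j) = 0"
    using sum_nonneg[of "{1..nspins S}" "\<lambda>j. ?c j - ?a j"] nonneg by fastforce
  then have "?c i - ?a i = 0"
    using sum_nonneg_eq_0_iff[of "{1..nspins S}" "\<lambda>j. ?c j - ?a j"] nonneg assms(3) by blast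
  then show ?thesis by simp
qed

end

theorem theorem2:
  fixes S :: "'v spin_system"
    and f :: "nat \<Rightarrow> real"
    and \<mu> :: "('v \<Rightarrow> nat) measure"
    and l :: nat
    and enum :: "('v \<rightharpoonup> nat) \<Rightarrow> 'v \<Rightarrow> 'v list"
  assumes "is_spin_system S"
    and "strong_spatial_mixing S f"
    and "gibbs_measure S \<mu>"
    and "sphere_ordering S l enum"
    and "\<And>v \<Lambda> \<sigma>. v \<in> verts S \<Longrightarrow> finite \<Lambda> \<Longrightarrow> \<Lambda> \<subseteq> verts S \<Longrightarrow> v \<notin> \<Lambda> \<Longrightarrow>
           \<sigma> \<in> configs S \<Lambda> \<Longrightarrow> 0 < marg_prob \<mu> \<sigma> \<Longrightarrow>
           termination_prob S \<mu> l enum \<sigma> v = 1"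
  shows "\<forall>v \<Lambda> \<sigma> i. v \<in> verts S \<and> finite \<Lambda> \<and> \<Lambda> \<subseteq> verts S \<and> v \<notin> \<Lambda> \<and>
           \<sigma> \<in> configs S \<Lambda> \<and> 0 < marg_prob \<mu> \<sigma> \<and> i \<in> {1..nspins S} \<longrightarrow>
           assign_prob S \<mu> l enum \<sigma> v i = cond_marg \<mu> \<sigma> v i"
proof (intro allI impI, elim conjE)
  fix v \<Lambda> \<sigma> i
  assume *: "v \<in> verts S" "finite \<Lambda>" "\<Lambda> \<subseteq> verts S" "v \<notin> \<Lambda>" "\<sigma> \<in> configs S \<Lambda>"
    "0 < marg_prob \<mu> \<sigma>" and i: "i \<in> {1..nspins S}"
  interpret ssms_setting S \<mu> l enum
    using assms(3,4) by unfold_locales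
  have "dom \<sigma> = \<Lambda>" using *(5) by (simp add: configs_def)
  then show "assign_prob S \<mu> l enum \<sigma> v i = cond_marg \<mu> \<sigma> v i"
    using * i by (intro assign_prob_eq assms(5)[OF *]) (auto simp: feasible_config_def)
qed

end
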